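(* Let $L>4$ be an integer, $\widehat L=L-1$, $\tau>0$, $\gamma>0$, and let $K\in\mathbb C^{M\times M}$ be self-adjoint ($K=K^*$) with eigenvalues $\{\sigma_m\}_{m=1}^M$ such that $1+\tau\sigma_m\neq0$ for all $m$. Let $\alpha\in\{1,-1\}$, and let $\widehat A$ and $P(\alpha)$ be, respectively, the rescaled implicit-Euler tracking-type all-at-once matrix and its ParaDiag preconditioner, as defined in the context. Then the eigenvalues of the preconditioned system matrix $P(\alpha)^{-1}\widehat A$ are all either $1$ or equal to $$\theta_{m,\{1,2\}}=1+\omega_{m,\{1,2\}}$$ for some $m\in\{1,\dots,M\}$, where $$\omega_{m,\{1,2\}}=\frac{1}{z_2-z_1}\left(\frac{z_1-\varphi\pm\psi\mathrm i}{1-\alpha z_1^{\widehat L}}-\frac{z_2-\varphi\pm\psi\mathrm i}{1-\alpha z_2^{\widehat L}}\right),\qquad z_{\{1,2\}}=\frac{1+\varphi^2+\psi^2\pm\sqrt{(1+\varphi^2+\psi^2)^2-4\varphi^2}}{2\varphi},$$ with $\varphi=(1+\tau\sigma_m)^{-1}$ and $\psi=\frac{\tau}{\sqrt\gamma}(1+\tau\sigma_m)^{-1}$.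
   Context: Here $L$ is the number of time steps, $\tau$ the time step, $\gamma$ the regularization parameter and $\widehat L=L-1$. Let $I_t$ be the $\widehat L\times\widehat L$ identity, $I_x$ the $M\times M$ identity, and $\otimes$ the Kronecker product. Let $B\in\mathbb R^{\widehat L\times\widehat L}$ have $1$ on the diagonal, $-1$ on the first subdiagonal and zeros elsewhere. Let $C(\alpha)\in\mathbb R^{\widehat L\times\widehat L}$ be equal to $B$ except that its top-right entry (row $1$, column $\widehat L$) is $-\alpha$. Define $$\widehat A=\begin{bmatrix}B&\frac{\tau}{\sqrt\gamma}I_t\\-\frac{\tau}{\sqrt\gamma}I_t&B^\top\end{bmatrix}\otimes I_x+\tau\begin{bmatrix}I_t&0\\0&I_t\end{bmatrix}\otimes K,\qquad P(\alpha)=\begin{bmatrix}C(\alpha)&\frac{\tau}{\sqrt\gamma}I_t\\-\frac{\tau}{\sqrt\gamma}I_t&C(\alpha)^*\end{bmatrix}\otimes I_x+\tau\begin{bmatrix}I_t&0\\0&I_t\end{bmatrix}\otimes K.$$ $\mathrm i$ is the imaginary unit. $z_1$ takes the sign $+$ and $z_2$ the sign $-$; $\omega_{m,1}$ takes the sign $+$ in both occurrences of $\pm$ and $\omega_{m,2}$ takes the sign $-$ in both occurrences. *)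

theory Defs
  imports
    "Jordan_Normal_Form.Schur_Decomposition"
    "Jordan_Normal_Form.Gauss_Jordan_Elimination"
begin

text \<open>
  Matrices and vectors are indexed from 0. The real data \<open>\<tau>\<close>, \<open>\<gamma>\<close> and the real matrices
  \<open>B\<close>, \<open>C(\<alpha>)\<close> are embedded into the complex numbers throughout.
\<close>

definition kronecker :: "complex mat \<Rightarrow> complex mat \<Rightarrow> complex mat" (infixl \<open>\<otimes>\<^sub>K\<close> 70) where
  "X \<otimes>\<^sub>K Y = mat (dim_row X * dim_row Y) (dim_col X * dim_col Y)
     (\<lambda>(i, j). X $$ (i div dim_row Y, j div dim_col Y) * Y $$ (i mod dim_row Y, j mod dim_col Y))"

definition B_mat :: "nat \<Rightarrow> complex mat" where
  "B_mat n = mat n n (\<lambda>(i, j). if i = j then 1 else if i = Suc j then - 1 else 0)"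

definition C_mat :: "nat \<Rightarrow> complex \<Rightarrow> complex mat" where
  "C_mat n \<alpha> = mat n n (\<lambda>(i, j). if i = 0 \<and> j = n - 1 then - \<alpha> else B_mat n $$ (i, j))"

text \<open>
  The common shape of \<open>\<hat>A\<close> and \<open>P(\<alpha>)\<close>; \<open>D\<^sub>1\<close> and \<open>D\<^sub>2\<close> are the \<open>n \<times> n\<close> diagonal blocks
  of the time-stepping part.
\<close>
definition all_at_once ::
  "nat \<Rightarrow> real \<Rightarrow> real \<Rightarrow> complex mat \<Rightarrow> complex mat \<Rightarrow> complex mat \<Rightarrow> complex mat" where
  "all_at_once n \<tau> \<gamma> K D\<^sub>1 D\<^sub>2 =
     four_block_mat D\<^sub>1 (complex_of_real (\<tau> / sqrt \<gamma>) \<cdot>\<^sub>m 1\<^sub>m n)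
                    (- (complex_of_real (\<tau> / sqrt \<gamma>) \<cdot>\<^sub>m 1\<^sub>m n)) D\<^sub>2
       \<otimes>\<^sub>K 1\<^sub>m (dim_row K)
     + complex_of_real \<tau> \<cdot>\<^sub>m
       (four_block_mat (1\<^sub>m n) (0\<^sub>m n n) (0\<^sub>m n n) (1\<^sub>m n) \<otimes>\<^sub>K K)"

definition A_hat :: "nat \<Rightarrow> real \<Rightarrow> real \<Rightarrow> complex mat \<Rightarrow> complex mat" where
  "A_hat n \<tau> \<gamma> K = all_at_once n \<tau> \<gamma> K (B_mat n) (transpose_mat (B_mat n))"

definition P_mat :: "nat \<Rightarrow> real \<Rightarrow> real \<Rightarrow> complex mat \<Rightarrow> complex \<Rightarrow> complex mat" where
  "P_mat n \<tau> \<gamma> K \<alpha> = all_at_once n \<tau> \<gamma> K (C_mat n \<alpha>) (mat_adjoint (C_mat n \<alpha>))"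

text \<open>
  The eigenvalues \<open>\<sigma>\<close> of \<open>K\<close> are taken as complex numbers. They are real because \<open>K\<close> is
  self-adjoint, so for the arguments of interest \<open>\<phi>\<close> and \<open>\<psi>\<close> are real, the radicand below is a
  positive real number, and \<open>csqrt\<close> is the usual real square root.
\<close>

definition phi :: "real \<Rightarrow> complex \<Rightarrow> complex" where
  "phi \<tau> \<sigma> = inverse (1 + complex_of_real \<tau> * \<sigma>)"

definition psi :: "real \<Rightarrow> real \<Rightarrow> complex \<Rightarrow> complex" where
  "psi \<tau> \<gamma> \<sigma> = complex_of_real (\<tau> / sqrt \<gamma>) * inverse (1 + complex_of_real \<tau> * \<sigma>)"

definition z1 :: "complex \<Rightarrow> complex \<Rightarrow> complex" where
  "z1 \<phi> \<psi> = (1 + \<phi>\<^sup>2 + \<psi>\<^sup>2 + csqrt ((1 + \<phi>\<^sup>2 + \<psi>\<^sup>2)\<^sup>2 - 4 * \<phi>\<^sup>2)) / (2 * \<phi>)"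

definition z2 :: "complex \<Rightarrow> complex \<Rightarrow> complex" where
  "z2 \<phi> \<psi> = (1 + \<phi>\<^sup>2 + \<psi>\<^sup>2 - csqrt ((1 + \<phi>\<^sup>2 + \<psi>\<^sup>2)\<^sup>2 - 4 * \<phi>\<^sup>2)) / (2 * \<phi>)"

definition omega1 :: "nat \<Rightarrow> complex \<Rightarrow> complex \<Rightarrow> complex \<Rightarrow> complex" where
  "omega1 n \<alpha> \<phi> \<psi> = 1 / (z2 \<phi> \<psi> - z1 \<phi> \<psi>) *
     ((z1 \<phi> \<psi> - \<phi> + \<psi> * \<i>) / (1 - \<alpha> * z1 \<phi> \<psi> ^ n) - (z2 \<phi> \<psi> - \<phi> + \<psi> * \<i>) / (1 - \<alpha> * z2 \<phi> \<psi> ^ n))"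

definition omega2 :: "nat \<Rightarrow> complex \<Rightarrow> complex \<Rightarrow> complex \<Rightarrow> complex" where
  "omega2 n \<alpha> \<phi> \<psi> = 1 / (z2 \<phi> \<psi> - z1 \<phi> \<psi>) *
     ((z1 \<phi> \<psi> - \<phi> - \<psi> * \<i>) / (1 - \<alpha> * z1 \<phi> \<psi> ^ n) - (z2 \<phi> \<psi> - \<phi> - \<psi> * \<i>) / (1 - \<alpha> * z2 \<phi> \<psi> ^ n))"

end

theory Submission
  imports Defs
begin

text \<open>
  Both matrices are Kronecker sums \<open>T\<^sub>\<beta> \<otimes> I\<^sub>x + \<tau> (I \<otimes> K)\<close>, where \<open>T\<^sub>\<beta>\<close> is the time block with corner entry
  \<open>-\<beta>\<close>: \<open>P(\<alpha>)\<close> has \<open>\<beta> = \<alpha>\<close>, and \<open>\<hat>A\<close> has \<open>\<beta> = 0\<close>. A kernel vector of such a sum is a solution of a Sylvester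
  equation, and a Schur form of \<open>K\<^sup>T\<close> extracts from it an eigenvector of the time factor alone, with
  eigenvalue determined by a single \<open>\<sigma>\<^sub>m\<close> (\<open>kronecker_sum_kernel\<close>). Self-adjointness of \<open>K\<close> makes \<open>\<sigma>\<^sub>m\<close>
  real. Applied to \<open>P(\<alpha>)\<close>, this reduces invertibility to the fact that \<open>T\<^sub>\<alpha>\<close> has no real eigenvalue,
  which comes from the skew coupling of state and adjoint (\<open>time_block_no_real_eigenvalue\<close>).

  If \<open>\<theta> \<noteq> 1\<close> is an eigenvalue of \<open>P(\<alpha>)\<^sup>-\<^sup>1 \<hat>A\<close>, then the reduction applies to \<open>\<hat>A - \<theta> P(\<alpha>)\<close> and gives a vector
  \<open>(y, p)\<close> satisfying, with \<open>s = 1 + \<tau> \<sigma>\<^sub>m\<close> and \<open>c = \<tau> / \<surd>\<gamma>\<close>, the undisturbed time stepping equations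
  \<open>y\<^sub>i = s y\<^sub>i\<^sub>+\<^sub>1 + c p\<^sub>i\<^sub>+\<^sub>1\<close> and \<open>p\<^sub>i\<^sub>+\<^sub>1 = s p\<^sub>i - c y\<^sub>i\<close>; only two closure conditions contain \<open>\<theta>\<close>. Reversing time while
  exchanging state and adjoint is a symmetry with square \<open>-1\<close>, and splitting along its eigenvalues
  \<open>\<plusminus>\<i>\<close> leaves one scalar sequence for each sign (\<open>time_block_pencil_eigenvalue\<close>). That sequence
  satisfies a second-order recurrence with characteristic roots \<open>z\<^sub>1\<close> and \<open>z\<^sub>2 = 1 / z\<^sub>1\<close>; its boundary
  conditions determine first the ratio of the two modes and then \<open>\<theta>\<close> (\<open>reflection_recurrence_eigenvalue\<close>,
  \<open>mode_ratio_omega\<close>). Since \<open>\<alpha>\<^sup>2 = 1\<close>, the corner values \<open>\<alpha> z\<^sub>1\<^sup>n\<close> and \<open>\<alpha> z\<^sub>2\<^sup>n\<close> are reciprocal too, which is what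
  lets the result collapse to the stated form.
\<close>

section \<open>Kernels of Kronecker sums\<close>

lemma index_split_bound:
  fixes i k N M :: nat
  assumes "i < N" "k < M"
  shows "i * M + k < N * M"
proof -
  have "i * M + k < Suc i * M" using assms by simp
  also have "\<dots> \<le> N * M" using assms by (intro mult_right_mono) auto
  finally show ?thesis .
qed

text \<open>
  Row-major order is the one under which the first Kronecker factor acts on the row index and the
  second one on the column index.
\<close>
definition reshape :: "nat \<Rightarrow> nat \<Rightarrow> 'a vec \<Rightarrow> 'a mat" where
  "reshape N M v = mat N M (\<lambda>(i, k). v $ (i * M + k))"

lemma reshape_carrier [simp]: "reshape N M v \<in> carrier_mat N M"
  by (simp add: reshape_def)

lemma reshape_dim [simp]: "dim_row (reshape N M v) = N" "dim_col (reshape N M v) = M"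
  by (simp_all add: reshape_def)

lemma reshape_eq_0_imp:
  assumes "v \<in> carrier_vec (N * M)" and "reshape N M v = 0\<^sub>m N M"
  shows "v = 0\<^sub>v (N * M)"
proof (rule eq_vecI)
  fix i assume i: "i < dim_vec (0\<^sub>v (N * M))"
  then have M: "M > 0" by (cases M) auto
  have d: "i div M < N" "i mod M < M"
    using i M by (auto simp: less_mult_imp_div_less)
  have "reshape N M v $$ (i div M, i mod M) = 0" using d assms(2) by simp
  then have "v $ i = 0" using d by (simp add: reshape_def)
  then show "v $ i = 0\<^sub>v (N * M) $ i" using i by simp
qed (use assms in auto)

lemma kronecker_carrier [simp]:
  "X \<in> carrier_mat a b \<Longrightarrow> Y \<in> carrier_mat c d \<Longrightarrow> X \<otimes>\<^sub>K Y \<in> carrier_mat (a * c) (b * d)"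
  by (auto simp: kronecker_def)

lemma kronecker_add_smult_left:
  assumes "X \<in> carrier_mat N N" "Y \<in> carrier_mat N N" "Z \<in> carrier_mat M M"
  shows "(X + a \<cdot>\<^sub>m Y) \<otimes>\<^sub>K Z = X \<otimes>\<^sub>K Z + a \<cdot>\<^sub>m (Y \<otimes>\<^sub>K Z)"
proof (rule eq_matI)
  fix i j assume "i < dim_row (X \<otimes>\<^sub>K Z + a \<cdot>\<^sub>m (Y \<otimes>\<^sub>K Z))" "j < dim_col (X \<otimes>\<^sub>K Z + a \<cdot>\<^sub>m (Y \<otimes>\<^sub>K Z))"
  then have ij: "i < N * M" "j < N * M" using assms by (auto simp: kronecker_def)
  then have "i div M < N" "j div M < N" by (simp_all add: less_mult_imp_div_less)
  then show "((X + a \<cdot>\<^sub>m Y) \<otimes>\<^sub>K Z) $$ (i, j) = (X \<otimes>\<^sub>K Z + a \<cdot>\<^sub>m (Y \<otimes>\<^sub>K Z)) $$ (i, j)"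
    using assms ij by (simp add: kronecker_def algebra_simps)
qed (use assms in \<open>auto simp: kronecker_def\<close>)

text \<open>
  The vec trick: after reshaping, a Kronecker product is a two-sided matrix multiplication, so that
  kernel vectors of \<open>X \<otimes>\<^sub>K 1 + c (1 \<otimes>\<^sub>K K)\<close> become solutions \<open>V\<close> of the Sylvester equation
  \<open>X V + c V K\<^sup>T = 0\<close>.
\<close>
lemma reshape_kronecker_mult_vec:
  assumes X: "X \<in> carrier_mat N N" and Y: "Y \<in> carrier_mat M M"
    and v: "v \<in> carrier_vec (N * M)"
  shows "reshape N M ((X \<otimes>\<^sub>K Y) *\<^sub>v v) = X * reshape N M v * transpose_mat Y"
proof (rule eq_matI)
  fix i k assume ik: "i < dim_row (X * reshape N M v * transpose_mat Y)"
    "k < dim_col (X * reshape N M v * transpose_mat Y)"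
  have i: "i < N" and k: "k < M" using ik X Y by auto
  have M: "M > 0" using k by simp
  have "reshape N M ((X \<otimes>\<^sub>K Y) *\<^sub>v v) $$ (i, k)
      = (\<Sum>q<N * M. X $$ (i, q div M) * Y $$ (k, q mod M) * v $ q)"
    using i k X Y v index_split_bound[OF i k]
    by (simp add: reshape_def kronecker_def scalar_prod_def atLeast0LessThan)
  also have "\<dots> = (\<Sum>j<N. \<Sum>q = j * M..<j * M + M. X $$ (i, q div M) * Y $$ (k, q mod M) * v $ q)"
    by (rule sum.nat_group [symmetric])
  also have "\<dots> = (\<Sum>j<N. \<Sum>l<M. X $$ (i, j) * Y $$ (k, l) * v $ (j * M + l))"
  proof (rule sum.cong[OF refl])
    fix j assume "j \<in> {..<N}"
    have "(\<Sum>q = j * M..<j * M + M. X $$ (i, q div M) * Y $$ (k, q mod M) * v $ q)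
      = (\<Sum>l = 0..<M. X $$ (i, (j * M + l) div M) * Y $$ (k, (j * M + l) mod M) * v $ (j * M + l))"
      using sum.shift_bounds_nat_ivl[of "\<lambda>q. X $$ (i, q div M) * Y $$ (k, q mod M) * v $ q" 0 "j * M" M]
      by (simp add: add.commute)
    also have "\<dots> = (\<Sum>l<M. X $$ (i, j) * Y $$ (k, l) * v $ (j * M + l))"
      using M by (intro sum.cong) auto
    finally show "(\<Sum>q = j * M..<j * M + M. X $$ (i, q div M) * Y $$ (k, q mod M) * v $ q)
      = (\<Sum>l<M. X $$ (i, j) * Y $$ (k, l) * v $ (j * M + l))" .
  qed
  also have "\<dots> = (\<Sum>l<M. \<Sum>j<N. X $$ (i, j) * Y $$ (k, l) * v $ (j * M + l))"
    by (rule sum.swap)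
  also have "\<dots> = (X * reshape N M v * transpose_mat Y) $$ (i, k)"
    using i k X Y
    by (simp add: scalar_prod_def reshape_def atLeast0LessThan sum_distrib_right sum_distrib_left ac_simps)
  finally show "reshape N M ((X \<otimes>\<^sub>K Y) *\<^sub>v v) $$ (i, k)
      = (X * reshape N M v * transpose_mat Y) $$ (i, k)" .
qed (use X Y in \<open>auto simp: reshape_def\<close>)

lemma smult_mat_mult_vec:
  fixes A :: "'a :: comm_ring_1 mat"
  assumes "v \<in> carrier_vec (dim_col A)"
  shows "(c \<cdot>\<^sub>m A) *\<^sub>v v = c \<cdot>\<^sub>v (A *\<^sub>v v)"
  using assms by (intro eq_vecI) auto

text \<open>
  Column \<open>k\<close> of \<open>W T\<close> combines columns \<open>0, \<dots>, k\<close> of \<open>W\<close>. At the first nonzero column of \<open>W\<close> only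
  the diagonal entry of \<open>T\<close> survives, and the Sylvester equation turns into an eigenvector equation
  for \<open>X\<close>.
\<close>
lemma sylvester_kernel_triangular:
  fixes X W T :: "complex mat"
  assumes X: "X \<in> carrier_mat N N" and W: "W \<in> carrier_mat N M" and T: "T \<in> carrier_mat M M"
    and ut: "upper_triangular T" and W0: "W \<noteq> 0\<^sub>m N M"
    and eq: "X * W + c \<cdot>\<^sub>m (W * T) = 0\<^sub>m N M"
  obtains k w where "k < M" "w \<in> carrier_vec N" "w \<noteq> 0\<^sub>v N" "X *\<^sub>v w = - (c * T $$ (k, k)) \<cdot>\<^sub>v w"
proof -
  have "\<exists>k<M. col W k \<noteq> 0\<^sub>v N"
  proof (rule ccontr)
    assume a: "\<not> ?thesis"
    have "W = 0\<^sub>m N M"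
    proof (rule eq_matI)
      fix i k assume "i < dim_row (0\<^sub>m N M)" "k < dim_col (0\<^sub>m N M)"
      then have "col W k $ i = W $$ (i, k)" using W by (simp add: index_col)
      moreover have "col W k = 0\<^sub>v N" using a \<open>k < dim_col (0\<^sub>m N M)\<close> by simp
      ultimately have "W $$ (i, k) = 0" using \<open>i < dim_row (0\<^sub>m N M)\<close> by simp
      then show "W $$ (i, k) = 0\<^sub>m N M $$ (i, k)"
        using \<open>i < dim_row (0\<^sub>m N M)\<close> \<open>k < dim_col (0\<^sub>m N M)\<close> by simp
    qed (use W in auto)
    then show False using W0 by simp
  qed
  then obtain k where k: "k < M" "col W k \<noteq> 0\<^sub>v N"
    and min: "\<And>l. l < k \<Longrightarrow> col W l = 0\<^sub>v N"
    using exists_least_iff[of "\<lambda>k. k < M \<and> col W k \<noteq> 0\<^sub>v N"] by (metis order.strict_trans)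
  have "X *\<^sub>v col W k = - (c * T $$ (k, k)) \<cdot>\<^sub>v col W k"
  proof (rule eq_vecI)
    fix i assume "i < dim_vec (- (c * T $$ (k, k)) \<cdot>\<^sub>v col W k)"
    then have i: "i < N" using W by simp
    have z: "W $$ (i, l) = 0" if "l < k" for l
    proof -
      have "col W l $ i = 0" using min[OF that] i by simp
      then show ?thesis using i that k W by simp
    qed
    have "(W * T) $$ (i, k) = (\<Sum>l = 0..<M. W $$ (i, l) * T $$ (l, k))"
      using i k W T by (simp add: scalar_prod_def)
    also have "\<dots> = (\<Sum>l \<in> {k}. W $$ (i, l) * T $$ (l, k))"
    proof (rule sum.mono_neutral_right)
      show "\<forall>l \<in> {0..<M} - {k}. W $$ (i, l) * T $$ (l, k) = 0"
      proof
        fix l assume l: "l \<in> {0..<M} - {k}"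
        show "W $$ (i, l) * T $$ (l, k) = 0"
          using z[of l] l upper_triangularD[OF ut, of k l] T by (cases "l < k") auto
      qed
    qed (use k in auto)
    finally have wt: "(W * T) $$ (i, k) = W $$ (i, k) * T $$ (k, k)" by simp
    have "(X * W + c \<cdot>\<^sub>m (W * T)) $$ (i, k) = 0" using eq i k by simp
    then have "(X * W) $$ (i, k) + c * (W * T) $$ (i, k) = 0" using i k X W T by simp
    then have "(X * W) $$ (i, k) = - (c * (W $$ (i, k) * T $$ (k, k)))"
      unfolding wt by (simp add: eq_neg_iff_add_eq_0)
    then show "(X *\<^sub>v col W k) $ i = (- (c * T $$ (k, k)) \<cdot>\<^sub>v col W k) $ i"
      using i k X W by simp
  qed (use X W in auto)
  moreover have "col W k \<in> carrier_vec N" using W k by auto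
  ultimately show ?thesis using that k by blast
qed

text \<open>
  This reduces a Kronecker sum to one eigenvalue of \<open>K\<close> at a time. Passing to a Schur form of \<open>K\<^sup>T\<close>
  makes the Sylvester equation triangular, with the \<open>\<sigma> m\<close> on the diagonal.
\<close>
lemma kronecker_sum_kernel:
  fixes X K :: "complex mat" and \<sigma> :: "nat \<Rightarrow> complex"
  assumes X: "X \<in> carrier_mat N N" and K: "K \<in> carrier_mat M M"
    and cp: "char_poly K = (\<Prod>m = 1..M. [:- \<sigma> m, 1:])"
    and v: "v \<in> carrier_vec (N * M)" "v \<noteq> 0\<^sub>v (N * M)"
    and ker: "(X \<otimes>\<^sub>K 1\<^sub>m M + c \<cdot>\<^sub>m (1\<^sub>m N \<otimes>\<^sub>K K)) *\<^sub>v v = 0\<^sub>v (N * M)"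
  obtains m w where "m \<in> {1..M}" "w \<in> carrier_vec N" "w \<noteq> 0\<^sub>v N" "X *\<^sub>v w = - (c * \<sigma> m) \<cdot>\<^sub>v w"
proof -
  let ?V = "reshape N M v" and ?Kt = "transpose_mat K"
  define es where "es = map \<sigma> [1..<Suc M]"
  have Kt: "?Kt \<in> carrier_mat M M" using K by simp
  have "char_poly ?Kt = (\<Prod>e \<leftarrow> es. [:- e, 1:])"
    using K cp by (simp add: es_def comp_def flip: prod.distinct_set_conv_list
        atLeastLessThanSuc_atLeastAtMost del: upt_Suc)
  moreover obtain T P Q where "schur_decomposition ?Kt es = (T, P, Q)"
    by (cases "schur_decomposition ?Kt es") auto
  ultimately have sim: "similar_mat_wit ?Kt T P Q" and ut: "upper_triangular T"
    and diag: "diag_mat T = es"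
    using schur_decomposition[OF Kt] by blast+
  note wit = similar_mat_witD2[OF Kt sim]
  have T: "T \<in> carrier_mat M M" and P: "P \<in> carrier_mat M M" and Q: "Q \<in> carrier_mat M M"
    and PQ: "P * Q = 1\<^sub>m M" and QP: "Q * P = 1\<^sub>m M" and KPTQ: "?Kt = P * T * Q"
    using wit by auto
  have V: "?V \<in> carrier_mat N M" by simp
  have XI: "X \<otimes>\<^sub>K 1\<^sub>m M \<in> carrier_mat (N * M) (N * M)"
    and IK: "1\<^sub>m N \<otimes>\<^sub>K K \<in> carrier_mat (N * M) (N * M)"
    using X K by simp_all
  have "X * ?V + c \<cdot>\<^sub>m (?V * ?Kt) = 0\<^sub>m N M"
  proof (rule eq_matI)
    fix i k assume "i < dim_row (0\<^sub>m N M)" "k < dim_col (0\<^sub>m N M)"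
    then have i: "i < N" and k: "k < M" by auto
    note b = index_split_bound[OF i k]
    have 1: "((X \<otimes>\<^sub>K 1\<^sub>m M) *\<^sub>v v) $ (i * M + k) = (X * ?V) $$ (i, k)"
      using arg_cong[OF reshape_kronecker_mult_vec[OF X one_carrier_mat v(1)], of "\<lambda>A. A $$ (i, k)"] i k
        right_mult_one_mat[OF mult_carrier_mat[OF X V]]
      by (simp add: reshape_def)
    have 2: "((1\<^sub>m N \<otimes>\<^sub>K K) *\<^sub>v v) $ (i * M + k) = (?V * ?Kt) $$ (i, k)"
      using arg_cong[OF reshape_kronecker_mult_vec[OF one_carrier_mat K v(1)], of "\<lambda>A. A $$ (i, k)"] i k
        left_mult_one_mat[OF V]
      by (simp add: reshape_def)
    have "(X \<otimes>\<^sub>K 1\<^sub>m M + c \<cdot>\<^sub>m (1\<^sub>m N \<otimes>\<^sub>K K)) *\<^sub>v v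
        = (X \<otimes>\<^sub>K 1\<^sub>m M) *\<^sub>v v + c \<cdot>\<^sub>v ((1\<^sub>m N \<otimes>\<^sub>K K) *\<^sub>v v)"
      using XI IK v by (subst add_mult_distrib_mat_vec[of _ "N * M" "N * M"])
        (auto simp: smult_mat_mult_vec carrier_matD[OF IK] simp del: kronecker_def)
    from arg_cong[OF this, of "\<lambda>x. x $ (i * M + k)"]
    have "(X * ?V) $$ (i, k) + c * (?V * ?Kt) $$ (i, k) = 0"
      unfolding ker 1[symmetric] 2[symmetric] using XI IK b by auto
    then show "(X * ?V + c \<cdot>\<^sub>m (?V * ?Kt)) $$ (i, k) = 0\<^sub>m N M $$ (i, k)"
      using i k X K V by simp
  qed (use X K in auto)
  then have "(X * ?V + c \<cdot>\<^sub>m (?V * ?Kt)) * P = 0\<^sub>m N M" using P by simp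
  moreover have "(X * ?V + c \<cdot>\<^sub>m (?V * ?Kt)) * P = X * ?V * P + c \<cdot>\<^sub>m (?V * ?Kt) * P"
    by (rule add_mult_distrib_mat) (use X V Kt P in auto)
  moreover have "X * ?V * P = X * (?V * P)" using X V P by (rule assoc_mult_mat)
  moreover have "c \<cdot>\<^sub>m (?V * ?Kt) * P = c \<cdot>\<^sub>m (?V * P * T)"
  proof -
    have "?Kt * P = P * T * (Q * P)"
      unfolding KPTQ using P T Q by (intro assoc_mult_mat) auto
    also have "\<dots> = P * T" using QP P T by simp
    finally have "?V * ?Kt * P = ?V * (P * T)"
      using assoc_mult_mat[OF V Kt P] by simp
    also have "\<dots> = ?V * P * T" using assoc_mult_mat[OF V P T] by simp
    finally show ?thesis using mult_smult_assoc_mat[OF mult_carrier_mat[OF V Kt] P, of c] by simp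
  qed
  ultimately have eq: "X * (?V * P) + c \<cdot>\<^sub>m (?V * P * T) = 0\<^sub>m N M" by simp
  have W0: "?V * P \<noteq> 0\<^sub>m N M"
  proof
    assume "?V * P = 0\<^sub>m N M"
    then have "?V * P * Q = 0\<^sub>m N M" using Q by simp
    then have "?V = 0\<^sub>m N M" using assoc_mult_mat[OF V P Q] PQ V by simp
    then show False using reshape_eq_0_imp[OF v(1)] v(2) by simp
  qed
  obtain k w where k: "k < M" and w: "w \<in> carrier_vec N" "w \<noteq> 0\<^sub>v N"
    and Xw: "X *\<^sub>v w = - (c * T $$ (k, k)) \<cdot>\<^sub>v w"
    using sylvester_kernel_triangular[OF X mult_carrier_mat[OF V P] T ut W0 eq] by blast
  have "T $$ (k, k) = es ! k" using k T by (simp add: diag_mat_def flip: diag)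
  also have "\<dots> = \<sigma> (Suc k)" using k by (simp add: es_def del: upt_Suc)
  finally show ?thesis using that[of "Suc k" w] k w Xw by simp
qed

section \<open>Adjoint matrices\<close>

lemma mat_adjoint_carrier [simp]:
  "A \<in> carrier_mat nr nc \<Longrightarrow> mat_adjoint A \<in> carrier_mat nc nr"
  by (auto simp: mat_adjoint_def)

lemma mat_adjoint_index:
  "A \<in> carrier_mat nr nc \<Longrightarrow> i < nc \<Longrightarrow> j < nr \<Longrightarrow> mat_adjoint A $$ (i, j) = conjugate (A $$ (j, i))"
  by (auto simp: mat_adjoint_def mat_of_rows_index)

lemma mat_adjoint_cscalar_prod:
  fixes A :: "complex mat"
  assumes A: "A \<in> carrier_mat nr nc" and x: "x \<in> carrier_vec nc" and y: "y \<in> carrier_vec nr"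
  shows "(A *\<^sub>v x) \<bullet>c y = x \<bullet>c (mat_adjoint A *\<^sub>v y)"
proof -
  have "(A *\<^sub>v x) \<bullet>c y = (\<Sum>i<nr. \<Sum>j<nc. A $$ (i, j) * x $ j * cnj (y $ i))"
    using A x y by (simp add: scalar_prod_def atLeast0LessThan sum_distrib_right)
  also have "\<dots> = (\<Sum>j<nc. \<Sum>i<nr. A $$ (i, j) * x $ j * cnj (y $ i))"
    by (rule sum.swap)
  also have "\<dots> = x \<bullet>c (mat_adjoint A *\<^sub>v y)"
    using A x y carrier_matD[OF mat_adjoint_carrier[OF A]]
    by (simp add: scalar_prod_def atLeast0LessThan sum_distrib_left mat_adjoint_index[OF A] ac_simps)
  finally show ?thesis .
qed

lemma self_adjoint_eigenvalue_real:
  fixes K :: "complex mat"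
  assumes K: "K \<in> carrier_mat M M" and adj: "mat_adjoint K = K" and ev: "eigenvalue K s"
  shows "s \<in> \<real>"
proof -
  obtain v where v: "v \<in> carrier_vec M" "v \<noteq> 0\<^sub>v M" "K *\<^sub>v v = s \<cdot>\<^sub>v v"
    using ev K by (auto simp: eigenvalue_def eigenvector_def)
  have "s * (v \<bullet>c v) = (K *\<^sub>v v) \<bullet>c v" using v by simp
  also have "\<dots> = v \<bullet>c (K *\<^sub>v v)" using mat_adjoint_cscalar_prod[OF K v(1) v(1)] adj by simp
  also have "\<dots> = cnj s * (v \<bullet>c v)" using v by (simp add: conjugate_smult_vec)
  finally have "s = cnj s" using v by simp
  then show ?thesis by (simp add: Reals_cnj_iff)
qed

section \<open>Inverses and preconditioned eigenvalue problems\<close>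

lemma invertible_if_trivial_kernel:
  fixes P :: "complex mat"
  assumes P: "P \<in> carrier_mat N N"
    and ker: "\<And>v. v \<in> carrier_vec N \<Longrightarrow> P *\<^sub>v v = 0\<^sub>v N \<Longrightarrow> v = 0\<^sub>v N"
  obtains Q where "mat_inverse P = Some Q" "Q \<in> carrier_mat N N" "P * Q = 1\<^sub>m N" "invertible_mat P"
proof -
  have "det P \<noteq> 0" using det_0_iff_vec_prod_zero_field[OF P] ker by blast
  then have "P \<in> Units (ring_mat TYPE(complex) N ())" by (rule det_non_zero_imp_unit[OF P])
  then obtain Q where Q: "mat_inverse P = Some Q"
    using mat_inverse(1)[OF P, of "()"] by (cases "mat_inverse P") auto
  note inv = mat_inverse(2)[OF P Q]
  have "invertible_mat P"
    unfolding invertible_mat_def inverts_mat_def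
    using P inv by (intro conjI exI[of _ Q]) auto
  then show ?thesis using that Q inv by blast
qed

lemma preconditioned_eigenvalueE:
  fixes P A Q :: "complex mat"
  assumes P: "P \<in> carrier_mat N N" and A: "A \<in> carrier_mat N N" and Q: "Q \<in> carrier_mat N N"
    and PQ: "P * Q = 1\<^sub>m N" and ev: "eigenvalue (Q * A) \<theta>"
  obtains v where "v \<in> carrier_vec N" "v \<noteq> 0\<^sub>v N" "(A + (- \<theta>) \<cdot>\<^sub>m P) *\<^sub>v v = 0\<^sub>v N"
proof -
  obtain v where v: "v \<in> carrier_vec N" "v \<noteq> 0\<^sub>v N" and QA: "(Q * A) *\<^sub>v v = \<theta> \<cdot>\<^sub>v v"
    using ev Q by (auto simp: eigenvalue_def eigenvector_def)
  have "A *\<^sub>v v = (P * Q) *\<^sub>v (A *\<^sub>v v)" using A v by (simp add: PQ)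
  also have "\<dots> = P *\<^sub>v ((Q * A) *\<^sub>v v)"
    using P Q A v by (simp add: assoc_mult_mat_vec[of _ N N _ N])
  also have "\<dots> = \<theta> \<cdot>\<^sub>v (P *\<^sub>v v)"
    unfolding QA by (rule mult_mat_vec[OF P v(1)])
  finally have Av: "A *\<^sub>v v = \<theta> \<cdot>\<^sub>v (P *\<^sub>v v)" .
  have "(A + (- \<theta>) \<cdot>\<^sub>m P) *\<^sub>v v = A *\<^sub>v v + (- \<theta>) \<cdot>\<^sub>v (P *\<^sub>v v)"
    using add_mult_distrib_mat_vec[OF A _ v(1), of "(- \<theta>) \<cdot>\<^sub>m P"] P v
    by (simp add: smult_mat_mult_vec)
  also have "\<dots> = 0\<^sub>v N" unfolding Av using P by (intro eq_vecI) auto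
  finally show ?thesis using that v by blast
qed

section \<open>The time-stepping block\<close>

text \<open>
  The factor that \<open>P(\<beta>)\<close> has in front of \<open>I\<^sub>x\<close>. The corner \<open>\<beta>\<close> is kept as a parameter because \<open>\<beta> = 0\<close>
  removes the periodic closure and gives back the block of \<open>\<hat>A\<close>, so that one family describes both
  matrices.
\<close>
definition time_block :: "nat \<Rightarrow> real \<Rightarrow> complex \<Rightarrow> complex mat" where
  "time_block n c \<beta> = four_block_mat (C_mat n \<beta>) (complex_of_real c \<cdot>\<^sub>m 1\<^sub>m n)
     (- (complex_of_real c \<cdot>\<^sub>m 1\<^sub>m n)) (mat_adjoint (C_mat n \<beta>))"

lemma C_mat_carrier [simp]: "C_mat n \<beta> \<in> carrier_mat n n"
  by (simp add: C_mat_def)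

lemma time_block_carrier [simp]: "time_block n c \<beta> \<in> carrier_mat (n + n) (n + n)"
  unfolding time_block_def by (rule four_block_carrier_mat) simp_all

lemma P_mat_eq:
  assumes "K \<in> carrier_mat M M"
  shows "P_mat n \<tau> \<gamma> K \<beta> = time_block n (\<tau> / sqrt \<gamma>) \<beta> \<otimes>\<^sub>K 1\<^sub>m M
    + complex_of_real \<tau> \<cdot>\<^sub>m (1\<^sub>m (n + n) \<otimes>\<^sub>K K)"
  using assms by (simp add: P_mat_def all_at_once_def time_block_def)

text \<open>
  For \<open>n = 1\<close> the corner is the diagonal entry, and \<open>\<beta> = 0\<close> would delete it.
\<close>
lemma A_hat_eq_P_mat_0:
  assumes "2 \<le> n"
  shows "A_hat n \<tau> \<gamma> K = P_mat n \<tau> \<gamma> K 0"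
proof -
  have B: "B_mat n = C_mat n 0"
    using assms by (intro eq_matI) (auto simp: B_mat_def C_mat_def)
  have "transpose_mat (B_mat n) = mat_adjoint (C_mat n 0)"
  proof (rule eq_matI)
    fix i j assume "i < dim_row (mat_adjoint (C_mat n 0))" "j < dim_col (mat_adjoint (C_mat n 0))"
    then have "i < n" "j < n" using carrier_matD[OF mat_adjoint_carrier[OF C_mat_carrier[of n 0]]] by auto
    then show "transpose_mat (B_mat n) $$ (i, j) = mat_adjoint (C_mat n 0) $$ (i, j)"
      unfolding B mat_adjoint_index[OF C_mat_carrier \<open>i < n\<close> \<open>j < n\<close>]
      by (simp add: C_mat_def B_mat_def)
  qed (use carrier_matD[OF mat_adjoint_carrier[OF C_mat_carrier[of n 0]]] in \<open>simp_all add: B_mat_def\<close>)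
  then show ?thesis by (simp add: A_hat_def P_mat_def B)
qed

lemma sum_two_entries:
  fixes y :: "nat \<Rightarrow> complex"
  assumes "a < n" "b < n"
  shows "(\<Sum>j = 0..<n. ((if j = a then 1 else 0) - (if j = b then \<beta> else 0)) * y j) = y a - \<beta> * y b"
proof -
  have "(\<Sum>j = 0..<n. ((if j = a then 1 else 0) - (if j = b then \<beta> else 0)) * y j)
      = (\<Sum>j = 0..<n. (if j = a then y j else 0) - (if j = b then \<beta> * y j else 0))"
    by (rule sum.cong) (auto simp: algebra_simps)
  also have "\<dots> = y a - \<beta> * y b" using assms by (simp add: sum_subtractf)
  finally show ?thesis .
qed

lemma C_mat_mult_vec:
  assumes n: "2 \<le> n" and i: "i < n" and y: "y \<in> carrier_vec n"
  shows "(C_mat n \<beta> *\<^sub>v y) $ i = y $ i - (if i = 0 then \<beta> * y $ (n - 1) else y $ (i - 1))"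
proof -
  let ?b = "if i = 0 then n - 1 else i - 1" and ?\<beta> = "if i = 0 then \<beta> else 1"
  have "(C_mat n \<beta> *\<^sub>v y) $ i = (\<Sum>j = 0..<n. C_mat n \<beta> $$ (i, j) * y $ j)"
    using i y by (simp add: scalar_prod_def C_mat_def)
  also have "\<dots> = (\<Sum>j = 0..<n. ((if j = i then 1 else 0) - (if j = ?b then ?\<beta> else 0)) * y $ j)"
    using n i by (intro sum.cong) (auto simp: C_mat_def B_mat_def)
  also have "\<dots> = y $ i - ?\<beta> * y $ ?b"
    by (rule sum_two_entries) (use n i in auto)
  finally show ?thesis by simp
qed

lemma C_mat_adjoint_mult_vec:
  assumes n: "2 \<le> n" and i: "i < n" and p: "p \<in> carrier_vec n"
  shows "(mat_adjoint (C_mat n \<beta>) *\<^sub>v p) $ i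
    = p $ i - (if i = n - 1 then cnj \<beta> * p $ 0 else p $ (Suc i))"
proof -
  let ?b = "if i = n - 1 then 0 else Suc i" and ?\<beta> = "if i = n - 1 then cnj \<beta> else 1"
  note C = C_mat_carrier[of n \<beta>]
  have "(mat_adjoint (C_mat n \<beta>) *\<^sub>v p) $ i = (\<Sum>j = 0..<n. cnj (C_mat n \<beta> $$ (j, i)) * p $ j)"
    using i p carrier_matD[OF mat_adjoint_carrier[OF C]]
    by (simp add: scalar_prod_def mat_adjoint_index[OF C])
  also have "\<dots> = (\<Sum>j = 0..<n. ((if j = i then 1 else 0) - (if j = ?b then ?\<beta> else 0)) * p $ j)"
    using n i by (intro sum.cong) (auto simp: C_mat_def B_mat_def)
  also have "\<dots> = p $ i - ?\<beta> * p $ ?b"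
    by (rule sum_two_entries) (use n i in auto)
  finally show ?thesis by simp
qed

lemma time_block_mult_append:
  assumes y: "y \<in> carrier_vec n" and p: "p \<in> carrier_vec n"
  shows "time_block n c \<beta> *\<^sub>v (y @\<^sub>v p)
    = (C_mat n \<beta> *\<^sub>v y + complex_of_real c \<cdot>\<^sub>v p)
      @\<^sub>v (- complex_of_real c \<cdot>\<^sub>v y + mat_adjoint (C_mat n \<beta>) *\<^sub>v p)"
proof -
  have 1: "(complex_of_real c \<cdot>\<^sub>m 1\<^sub>m n) *\<^sub>v p = complex_of_real c \<cdot>\<^sub>v p"
    using p by (simp add: smult_mat_mult_vec)
  have "- (complex_of_real c \<cdot>\<^sub>m 1\<^sub>m n) = (- complex_of_real c) \<cdot>\<^sub>m 1\<^sub>m n"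
    by (intro eq_matI) auto
  then have 2: "(- (complex_of_real c \<cdot>\<^sub>m 1\<^sub>m n)) *\<^sub>v y = - complex_of_real c \<cdot>\<^sub>v y"
    using y by (simp add: smult_mat_mult_vec)
  show ?thesis
    unfolding time_block_def 1[symmetric] 2[symmetric]
    by (rule four_block_mat_mult_vec[of _ n n _ n _ n]) (use y p in simp_all)
qed

text \<open>
  The reason for invertibility of the preconditioner: the coupling is skew while the diagonal blocks
  are adjoint to each other. Pairing the first block row of \<open>T w = r w\<close> with \<open>p\<close> and the second one
  with \<open>y\<close>, the contributions of \<open>C\<close> and of the real number \<open>r\<close> agree and leave
  \<open>c (\<parallel>y\<parallel>\<^sup>2 + \<parallel>p\<parallel>\<^sup>2) = 0\<close>.
\<close>
lemma time_block_no_real_eigenvalue: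
  assumes c: "c \<noteq> 0" and w: "w \<in> carrier_vec (n + n)"
    and eq: "time_block n c \<beta> *\<^sub>v w = complex_of_real r \<cdot>\<^sub>v w"
  shows "w = 0\<^sub>v (n + n)"
proof -
  define y p where "y = vec_first w n" and "p = vec_last w n"
  have y: "y \<in> carrier_vec n" and p: "p \<in> carrier_vec n" and wyp: "w = y @\<^sub>v p"
    using w by (simp_all add: y_def p_def)
  let ?C = "C_mat n \<beta>"
  have Cy: "?C *\<^sub>v y \<in> carrier_vec n" and Cp: "mat_adjoint ?C *\<^sub>v p \<in> carrier_vec n"
    using y p by (auto intro!: mult_mat_vec_carrier)
  have "(?C *\<^sub>v y + complex_of_real c \<cdot>\<^sub>v p) @\<^sub>v (- complex_of_real c \<cdot>\<^sub>v y + mat_adjoint ?C *\<^sub>v p)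
      = complex_of_real r \<cdot>\<^sub>v y @\<^sub>v complex_of_real r \<cdot>\<^sub>v p"
  proof -
    have "complex_of_real r \<cdot>\<^sub>v (y @\<^sub>v p) = complex_of_real r \<cdot>\<^sub>v y @\<^sub>v complex_of_real r \<cdot>\<^sub>v p"
      by (intro eq_vecI) auto
    then show ?thesis using eq unfolding wyp time_block_mult_append[OF y p] by (simp only:)
  qed
  then have e: "?C *\<^sub>v y + complex_of_real c \<cdot>\<^sub>v p = complex_of_real r \<cdot>\<^sub>v y"
    "- complex_of_real c \<cdot>\<^sub>v y + mat_adjoint ?C *\<^sub>v p = complex_of_real r \<cdot>\<^sub>v p"
    using Cy Cp y p by (subst (asm) append_vec_eq[of _ n]; simp)+
  note dims = carrier_matD[OF C_mat_carrier[of n \<beta>]]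
    carrier_matD[OF mat_adjoint_carrier[OF C_mat_carrier[of n \<beta>]]]
  have 1: "?C *\<^sub>v y = complex_of_real r \<cdot>\<^sub>v y + complex_of_real (- c) \<cdot>\<^sub>v p"
    using y p dims by (intro eq_vecI) (auto simp flip: e(1))
  have 2: "mat_adjoint ?C *\<^sub>v p = complex_of_real r \<cdot>\<^sub>v p + complex_of_real c \<cdot>\<^sub>v y"
    using y p dims by (intro eq_vecI) (auto simp flip: e(2))
  have cy: "conjugate y \<in> carrier_vec n" and cp: "conjugate p \<in> carrier_vec n" using y p by auto
  have "(?C *\<^sub>v y) \<bullet>c p = complex_of_real r * (y \<bullet>c p) - complex_of_real c * (p \<bullet>c p)"
    unfolding 1 using y p cp by (simp add: add_scalar_prod_distrib[of _ n])
  moreover have "y \<bullet>c (mat_adjoint ?C *\<^sub>v p) = complex_of_real r * (y \<bullet>c p) + complex_of_real c * (y \<bullet>c y)"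
    unfolding 2 using y p cp cy
    by (simp add: conjugate_add_vec[of _ n] scalar_prod_add_distrib[of _ n] conjugate_smult_vec)
  moreover have "(?C *\<^sub>v y) \<bullet>c p = y \<bullet>c (mat_adjoint ?C *\<^sub>v p)"
    by (rule mat_adjoint_cscalar_prod) (use y p in auto)
  ultimately have "complex_of_real c * (y \<bullet>c y + p \<bullet>c p) = 0" by (simp add: algebra_simps)
  then have "y \<bullet>c y + p \<bullet>c p = 0" using c by simp
  moreover have "0 \<le> y \<bullet>c y" "0 \<le> p \<bullet>c p" by (rule conjugate_square_ge_0_vec)+
  ultimately have "y \<bullet>c y = 0" "p \<bullet>c p = 0"
    by (simp_all add: add_nonneg_eq_0_iff)
  then have "y = 0\<^sub>v n" "p = 0\<^sub>v n" using y p by auto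
  then show ?thesis unfolding wyp by (auto simp: vec_eq_iff append_vec_def)
qed

section \<open>The scalar boundary value problem\<close>

text \<open>
  \<open>z\<^sub>1\<close> and \<open>z\<^sub>2\<close> are the roots of \<open>\<phi> z\<^sup>2 - (1 + \<phi>\<^sup>2 + \<psi>\<^sup>2) z + \<phi>\<close>. The discriminant factors as
  \<open>((1 - \<phi>)\<^sup>2 + \<psi>\<^sup>2) ((1 + \<phi>)\<^sup>2 + \<psi>\<^sup>2)\<close>, which is positive for real \<open>\<phi>\<close> and real \<open>\<psi> \<noteq> 0\<close>; hence the roots
  are real, distinct and reciprocal, and neither lies on the unit circle.
\<close>
lemma characteristic_roots:
  fixes \<phi> \<psi> :: complex
  assumes "\<phi> \<in> \<real>" "\<psi> \<in> \<real>" "\<phi> \<noteq> 0" "\<psi> \<noteq> 0"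
  shows "z1 \<phi> \<psi> \<in> \<real>" "z1 \<phi> \<psi> * z2 \<phi> \<psi> = 1" "\<phi> * (z1 \<phi> \<psi> + z2 \<phi> \<psi>) = 1 + \<phi>\<^sup>2 + \<psi>\<^sup>2"
    "z1 \<phi> \<psi> \<noteq> z2 \<phi> \<psi>"
proof -
  obtain f p :: real where fp: "\<phi> = of_real f" "\<psi> = of_real p"
    using assms by (auto elim!: Reals_cases)
  have nz: "f \<noteq> 0" "p \<noteq> 0" using assms fp by auto
  define R where "R = 1 + f\<^sup>2 + p\<^sup>2"
  define q where "q = sqrt (R\<^sup>2 - 4 * f\<^sup>2)"
  have "R\<^sup>2 - 4 * f\<^sup>2 = ((1 - f)\<^sup>2 + p\<^sup>2) * ((1 + f)\<^sup>2 + p\<^sup>2)"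
    by (simp add: R_def power2_eq_square algebra_simps)
  also have "\<dots> > 0" using nz by (intro mult_pos_pos add_nonneg_pos) auto
  finally have pos: "R\<^sup>2 - 4 * f\<^sup>2 > 0" .
  then have q: "q > 0" "q\<^sup>2 = R\<^sup>2 - 4 * f\<^sup>2" by (auto simp: q_def)
  have "(1 + \<phi>\<^sup>2 + \<psi>\<^sup>2)\<^sup>2 - 4 * \<phi>\<^sup>2 = of_real (R\<^sup>2 - 4 * f\<^sup>2)"
    by (simp add: fp R_def)
  then have sq: "csqrt ((1 + \<phi>\<^sup>2 + \<psi>\<^sup>2)\<^sup>2 - 4 * \<phi>\<^sup>2) = of_real q"
    using pos by (simp only: q_def) (subst csqrt_of_real_nonneg, simp_all)
  have RC: "1 + \<phi>\<^sup>2 + \<psi>\<^sup>2 = of_real R" by (simp add: fp R_def)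
  have z: "z1 \<phi> \<psi> = of_real ((R + q) / (2 * f))" "z2 \<phi> \<psi> = of_real ((R - q) / (2 * f))"
    unfolding z1_def z2_def sq unfolding RC unfolding fp(1) by simp_all
  show "z1 \<phi> \<psi> \<in> \<real>" by (simp only: z Reals_of_real)
  have "(R + q) * (R - q) = R\<^sup>2 - q\<^sup>2" by (simp add: algebra_simps power2_eq_square)
  also have "\<dots> = 2 * f * (2 * f)" using q(2) by (simp add: power2_eq_square)
  finally have "(R + q) / (2 * f) * ((R - q) / (2 * f)) = 1"
    using nz by (simp only: times_divide_times_eq) simp
  then show "z1 \<phi> \<psi> * z2 \<phi> \<psi> = 1" unfolding z by (simp only: of_real_1 flip: of_real_mult)
  have "f * ((R + q) / (2 * f) + (R - q) / (2 * f)) = R"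
    using nz by (simp add: add_divide_distrib [symmetric])
  then show "\<phi> * (z1 \<phi> \<psi> + z2 \<phi> \<psi>) = 1 + \<phi>\<^sup>2 + \<psi>\<^sup>2"
    unfolding RC unfolding z unfolding fp(1) by (simp only: flip: of_real_mult of_real_add)
  have "(R + q) / (2 * f) \<noteq> (R - q) / (2 * f)" using nz q(1) by simp
  then show "z1 \<phi> \<psi> \<noteq> z2 \<phi> \<psi>" unfolding z of_real_eq_iff .
qed

text \<open>
  The general solution of a second-order recurrence with characteristic roots \<open>r1\<close> and \<open>r2\<close>, scaled by
  \<open>r1 - r2\<close> to avoid divisions. The recurrence is assumed only at the interior points of
  \<open>{0..n}\<close>.
\<close>
lemma second_order_recurrence_solution:
  fixes Y :: "nat \<Rightarrow> complex"
  assumes prod: "r1 * r2 = 1" and f: "f \<noteq> 0"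
    and rec: "\<And>k. Suc k < n \<Longrightarrow> f * (Y (Suc (Suc k)) + Y k) = f * (r1 + r2) * Y (Suc k)"
    and k: "k \<le> n" and n: "0 < n"
  shows "(r1 - r2) * Y k = r1 ^ k * (Y 1 - r2 * Y 0) + r2 ^ k * (r1 * Y 0 - Y 1)"
  using k
proof (induction k rule: induct_nat_012)
  case 0
  then show ?case by (simp add: algebra_simps)
next
  case 1
  then show ?case by (simp add: algebra_simps)
next
  case (ge2 k)
  have "Y (Suc (Suc k)) = (r1 + r2) * Y (Suc k) - Y k"
  proof -
    have "f * (Y (Suc (Suc k)) + Y k) = f * ((r1 + r2) * Y (Suc k))"
      using rec[of k] ge2.prems by (simp add: mult.assoc)
    then have "Y (Suc (Suc k)) + Y k = (r1 + r2) * Y (Suc k)" using f by simp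
    then show ?thesis by (simp add: eq_diff_eq)
  qed
  then have "(r1 - r2) * Y (Suc (Suc k))
      = (r1 + r2) * ((r1 - r2) * Y (Suc k)) - (r1 * r2) * ((r1 - r2) * Y k)"
    unfolding prod by (simp only:) (simp add: algebra_simps)
  also have "\<dots> = r1 ^ Suc (Suc k) * (Y 1 - r2 * Y 0) + r2 ^ Suc (Suc k) * (r1 * Y 0 - Y 1)"
    using ge2 by (simp only: Suc_leD) (simp add: algebra_simps)
  finally show ?case .
qed

text \<open>
  The algebra behind the formula for \<open>\<omega>\<close>. Let \<open>A\<close> and \<open>B\<close> be the amplitudes of the two modes, let \<open>e\<close>
  be a square root of \<open>(r1 - \<phi>) (r2 - \<phi>)\<close>, and think of \<open>X\<close> as \<open>\<alpha> r1\<^sup>n\<close>, so that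
  \<open>1 / X = \<alpha> r2\<^sup>n\<close>. The left boundary condition \<open>bc\<close> fixes the ratio of \<open>A\<close> and \<open>B\<close>, and the closure condition \<open>w\<close> then fixes the eigenvalue shift.
  The choice of \<open>e\<close> makes \<open>(r1 - \<phi> + e X, r2 - \<phi> + e / X)\<close> proportional to
  \<open>(e - r1 + \<phi>, (r2 - \<phi> - e) / X)\<close>; this is why \<open>e\<close> enters the result with the opposite sign.
\<close>
lemma mode_ratio_omega:
  fixes r1 r2 \<phi> e X A B w :: complex
  assumes e: "e\<^sup>2 = (r1 - \<phi>) * (r2 - \<phi>)" and X: "X \<noteq> 0" "X \<noteq> 1" and r: "r1 \<noteq> r2"
    and nz: "r1 - \<phi> + e * X \<noteq> 0"
    and bc: "A * (r1 - \<phi> + e * X) + B * (r2 - \<phi> + e / X) = 0"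
    and w: "w * (A + B - (A * X + B / X)) = A * X + B / X"
    and u: "A + B \<noteq> A * X + B / X"
  shows "w = 1 / (r2 - r1) * ((r1 - \<phi> - e) / (1 - X) - (r2 - \<phi> - e) / (1 - 1 / X))"
proof -
  define x1 x2 where "x1 = r1 - \<phi>" and "x2 = r2 - \<phi>"
  define D where "D = B / X"
  have B: "B = D * X" using X by (simp add: D_def)
  have ee: "e * e = x1 * x2" using e by (simp add: x1_def x2_def power2_eq_square)
  have bc': "A * (x1 + e * X) + D * (x2 * X + e) = 0"
  proof -
    have "B * (x2 + e / X) = D * (x2 * X + e)" using X by (simp add: B field_simps)
    then show ?thesis using bc by (simp add: x1_def x2_def)
  qed
  have "(x1 + e * X) * (A * (e - x1) + D * (x2 - e))
      = (e - x1) * (A * (x1 + e * X) + D * (x2 * X + e))"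
  proof -
    have "(x1 + e * X) * (x2 - e) = (e - x1) * (x2 * X + e)"
    proof -
      have "(x1 + e * X) * (x2 - e) = x1 * x2 - x1 * e + e * X * x2 - X * (e * e)"
        by (simp add: algebra_simps)
      also have "\<dots> = e * X * x2 + e * e - X * (x1 * x2) - x1 * e"
        unfolding ee by (simp add: algebra_simps)
      also have "\<dots> = (e - x1) * (x2 * X + e)" by (simp add: algebra_simps)
      finally show ?thesis .
    qed
    then have "D * ((x1 + e * X) * (x2 - e)) = D * ((e - x1) * (x2 * X + e))" by simp
    then show ?thesis by (simp add: algebra_simps)
  qed
  then have rel: "A * (e - x1) + D * (x2 - e) = 0"
    using bc' nz by (simp add: x1_def)
  have u': "(1 - X) * (A - D) \<noteq> 0"
    using u X by (simp add: B algebra_simps)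
  have w': "w * ((1 - X) * (A - D)) = A * X + D"
    using w X by (simp add: B algebra_simps)
  have id: "(A * X + D) * (x2 - x1) = (A - D) * (x2 * X + x1 - e * (1 + X))"
  proof -
    have "(A * X + D) * (x2 - x1) - (A - D) * (x2 * X + x1 - e * (1 + X))
        = (1 + X) * (A * (e - x1) + D * (x2 - e))"
      by (simp add: algebra_simps)
    then show ?thesis using rel by simp
  qed
  have "w * (1 - X) * (x2 - x1) * (A - D) = (x2 * X + x1 - e * (1 + X)) * (A - D)"
  proof -
    have "w * (1 - X) * (x2 - x1) * (A - D) = w * ((1 - X) * (A - D)) * (x2 - x1)"
      by (simp only: ac_simps)
    then show ?thesis unfolding w' id by (simp only: mult.commute)
  qed
  then have "w * (1 - X) * (x2 - x1) = x2 * X + x1 - e * (1 + X)" using u' by simp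
  then have "w = (x2 * X + x1 - e * (1 + X)) / ((1 - X) * (x2 - x1))"
  proof -
    have "(1 - X) * (x2 - x1) \<noteq> 0" using X r by (simp add: x1_def x2_def)
    then show ?thesis using \<open>w * (1 - X) * (x2 - x1) = x2 * X + x1 - e * (1 + X)\<close>
      by (metis mult.assoc nonzero_eq_divide_eq)
  qed
  also have "\<dots> = 1 / (x2 - x1) * ((x1 - e) / (1 - X) + X * (x2 - e) / (1 - X))"
    by (simp add: algebra_simps flip: add_divide_distrib diff_divide_distrib)
  also have "X * (x2 - e) / (1 - X) = - ((x2 - e) / (1 - 1 / X))"
    using X by (simp add: field_simps)
  finally show ?thesis by (simp add: x1_def x2_def)
qed

text \<open>
  The scalar form of the eigenvalue problem, after the state and the reversed adjoint have been
  merged into one sequence \<open>u\<close>. Prepending the value that the recurrence would give to \<open>u\<close> at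
  index \<open>-1\<close> yields \<open>Y\<^sub>0, \<dots>, Y\<^sub>n\<close> with \<open>Y\<^sub>k = s Y\<^sub>k\<^sub>+\<^sub>1 - \<delta> c Y\<^sub>n\<^sub>-\<^sub>k\<close>. Using this relation twice eliminates the
  reflected entry and leaves the second-order recurrence with roots \<open>z\<^sub>1\<close> and \<open>z\<^sub>2\<close>, with the case
  \<open>k = 0\<close> and the closure condition as boundary conditions.
\<close>
lemma reflection_recurrence_eigenvalue:
  fixes u :: "nat \<Rightarrow> complex" and s c :: real and \<alpha> \<delta> \<theta> :: complex
  assumes n: "0 < n" and s: "s \<noteq> 0" and c: "c \<noteq> 0" and \<alpha>: "\<alpha> \<in> {1, -1}" and \<delta>: "\<delta> \<in> {\<i>, - \<i>}"
    and rec: "\<And>i. Suc i < n \<Longrightarrow> u i = s * u (Suc i) - \<delta> * c * u (n - Suc (Suc i))"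
    and bdry: "\<theta> * (\<alpha> * u (n - 1)) = (\<theta> - 1) * (s * u 0 - \<delta> * c * u (n - 1))"
    and nz: "i < n" "u i \<noteq> 0"
    and \<phi>: "\<phi> = inverse (of_real s)" and \<psi>: "\<psi> = of_real c * inverse (of_real s)"
  shows "\<theta> = 1 + 1 / (z2 \<phi> \<psi> - z1 \<phi> \<psi>) *
     ((z1 \<phi> \<psi> - \<phi> + \<psi> * (\<delta> * \<alpha>)) / (1 - \<alpha> * z1 \<phi> \<psi> ^ n)
      - (z2 \<phi> \<psi> - \<phi> + \<psi> * (\<delta> * \<alpha>)) / (1 - \<alpha> * z2 \<phi> \<psi> ^ n))"
proof -
  define r1 r2 where "r1 = z1 \<phi> \<psi>" and "r2 = z2 \<phi> \<psi>"
  have sphi: "s * \<phi> = 1" using s \<phi> by simp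
  have psi: "\<psi> = c * \<phi>" using \<phi> \<psi> by simp
  have fr: "\<phi> \<in> \<real>" "\<psi> \<in> \<real>" "\<phi> \<noteq> 0" "\<psi> \<noteq> 0" using \<phi> \<psi> s c by auto
  note z = characteristic_roots[OF fr, folded r1_def r2_def]
  have dd: "\<delta> * \<delta> = -1" using \<delta> by auto
  have aa: "\<alpha> * \<alpha> = 1" using \<alpha> by auto
  \<comment> \<open>index shifted by one: \<open>Y 0\<close> is the prepended value\<close>
  define Y where "Y k = (case k of 0 \<Rightarrow> s * u 0 - \<delta> * c * u (n - 1) | Suc j \<Rightarrow> u j)" for k
  have step: "Y k = s * Y (Suc k) - \<delta> * c * Y (n - k)" if k: "k < n" for k
  proof (cases k)
    case 0
    then show ?thesis using n by (simp add: Y_def split: nat.split)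
  next
    case (Suc j)
    then have "n - k = Suc (n - Suc (Suc j))" using k by simp
    then show ?thesis using rec[of j] Suc k by (simp add: Y_def)
  qed
  have rec2: "\<phi> * (Y (Suc (Suc k)) + Y k) = \<phi> * (r1 + r2) * Y (Suc k)" if k: "Suc k < n" for k
  proof -
    have e1: "Y k = s * Y (Suc k) - \<delta> * c * Y (n - k)" by (rule step) (use k in simp)
    have e2: "Y (Suc k) = s * Y (Suc (Suc k)) - \<delta> * c * Y (n - Suc k)" by (rule step) (use k in simp)
    have e3: "Y (n - Suc k) = s * Y (n - k) - \<delta> * c * Y (Suc k)"
    proof -
      have "n - Suc k < n" "Suc (n - Suc k) = n - k" "n - (n - Suc k) = Suc k" using k by auto
      then show ?thesis using step[of "n - Suc k"] by (simp only:)
    qed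
    have "s * (Y (Suc (Suc k)) + Y k) = (1 + s * s + c * c) * Y (Suc k)"
    proof -
      have 2: "s * Y (Suc (Suc k)) = Y (Suc k) + \<delta> * c * Y (n - Suc k)" using e2 by simp
      have 3: "Y (n - Suc k) - s * Y (n - k) = - (\<delta> * c * Y (Suc k))" using e3 by simp
      have "s * (Y (Suc (Suc k)) + Y k)
          = Y (Suc k) + s * s * Y (Suc k) + \<delta> * c * (Y (n - Suc k) - s * Y (n - k))"
        unfolding e1 distrib_left 2 by (simp add: algebra_simps)
      also have "\<dots> = Y (Suc k) + s * s * Y (Suc k) - (\<delta> * \<delta>) * (c * c * Y (Suc k))"
        unfolding 3 by (simp add: algebra_simps)
      finally show ?thesis unfolding dd by (simp add: algebra_simps)
    qed
    note sys = this
    have "\<phi> * (Y (Suc (Suc k)) + Y k) = \<phi> * (s * \<phi>) * (Y (Suc (Suc k)) + Y k)"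
      unfolding sphi by simp
    also have "\<dots> = \<phi> * \<phi> * (s * (Y (Suc (Suc k)) + Y k))" by (simp only: ac_simps)
    also have "\<dots> = (\<phi>\<^sup>2 + (s * \<phi>)\<^sup>2 + (c * \<phi>)\<^sup>2) * Y (Suc k)"
      unfolding sys by (simp add: algebra_simps power2_eq_square)
    also have "\<dots> = (1 + \<phi>\<^sup>2 + \<psi>\<^sup>2) * Y (Suc k)"
      unfolding sphi psi by simp
    finally have "\<phi> * (Y (Suc (Suc k)) + Y k) = (1 + \<phi>\<^sup>2 + \<psi>\<^sup>2) * Y (Suc k)" .
    then show ?thesis using z(3) by simp
  qed
  define A B where "A = Y 1 - r2 * Y 0" and "B = r1 * Y 0 - Y 1"
  have sol: "(r1 - r2) * Y k = r1 ^ k * A + r2 ^ k * B" if "k \<le> n" for k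
    using second_order_recurrence_solution[of r1 r2 \<phi> n Y k, OF z(2) fr(3) rec2 that n]
    unfolding A_def B_def .
  have AB: "A \<noteq> 0 \<or> B \<noteq> 0"
  proof (rule ccontr)
    assume "\<not> ?thesis"
    then have "A = 0" "B = 0" by simp_all
    have "(r1 - r2) * Y (Suc i) = 0"
      using sol[OF Suc_leI[OF nz(1)]] unfolding \<open>A = 0\<close> \<open>B = 0\<close> by simp
    moreover have "Y (Suc i) = u i" by (simp add: Y_def)
    ultimately show False using z(4) nz(2) by simp
  qed
  define t where "t = r1 ^ n"
  define X where "X = \<alpha> * t"
  have r1nz: "r1 \<noteq> 0" using z(2) by auto
  have r2: "r2 = 1 / r1" using z(2) r1nz by (simp add: field_simps)
  have tinv: "r2 ^ n = 1 / t" by (simp add: t_def r2 power_one_over)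
  have tnz: "t \<noteq> 0" using r1nz by (simp add: t_def)
  have Xnz: "X \<noteq> 0" using tnz \<alpha> by (auto simp: X_def)
  have Xinv: "1 / X = \<alpha> * r2 ^ n" using \<alpha> by (auto simp: X_def tinv)
  have Xreal: "X \<in> \<real>" using z(1) \<alpha> by (auto simp: X_def t_def)
  have norm: "norm r1 \<noteq> 1"
  proof
    assume "norm r1 = 1"
    moreover obtain a where a: "r1 = of_real a" using z(1) by (auto elim: Reals_cases)
    ultimately have "\<bar>a\<bar> = 1" by simp
    then have "a * a = 1" by (metis abs_mult_self_eq mult_1)
    then have "r1 * r1 = r1 * r2" unfolding z(2) unfolding a by (metis of_real_1 of_real_mult)
    then show False using z(4) r1nz by (simp only: mult_cancel_left) simp
  qed
  have tt: "t * t \<noteq> 1"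
  proof
    assume "t * t = 1"
    then have "r1 ^ (2 * n) = 1" by (simp only: t_def mult_2 power_add)
    then show False using power_eq_1_iff[of r1 "2 * n"] norm n by simp
  qed
  have "X * X = (\<alpha> * \<alpha>) * (t * t)" by (simp add: X_def)
  then have X2: "X * X \<noteq> 1" using tt unfolding aa by simp
  then have X1: "X \<noteq> 1" by auto
  define e where "e = - (\<delta> * \<psi> * \<alpha>)"
  have e2: "e\<^sup>2 = (r1 - \<phi>) * (r2 - \<phi>)"
  proof -
    have "e\<^sup>2 = (\<delta> * \<delta>) * (\<alpha> * \<alpha>) * \<psi>\<^sup>2"
      unfolding e_def power2_eq_square by simp
    also have "\<dots> = 1 + \<phi>\<^sup>2 - (1 + \<phi>\<^sup>2 + \<psi>\<^sup>2)" unfolding dd aa by simp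
    also have "\<dots> = r1 * r2 + \<phi>\<^sup>2 - \<phi> * (r1 + r2)" unfolding z(2,3) ..
    also have "\<dots> = (r1 - \<phi>) * (r2 - \<phi>)" by (simp add: algebra_simps power2_eq_square)
    finally show ?thesis .
  qed
  \<comment> \<open>the first part is real, the second one is a nonzero imaginary number\<close>
  have nz': "r1 - \<phi> + e * X \<noteq> 0"
  proof
    assume 0: "r1 - \<phi> + e * X = 0"
    have real: "Im r1 = 0" "Im \<phi> = 0" "Im (\<psi> * \<alpha> * X) = 0"
      using z(1) fr(1,2) Xreal \<alpha> by (auto simp: complex_is_Real_iff)
    have "Im (\<delta> * (\<psi> * \<alpha> * X)) = 0"
      using arg_cong[OF 0, of Im] real(1,2) by (simp add: e_def mult.assoc)
    then have "Re (\<psi> * \<alpha> * X) = 0" using \<delta> by auto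
    then have "\<psi> * \<alpha> * X = 0" using real(3) by (simp only: complex_eq_iff zero_complex.sel)
    then show False using \<alpha> fr(4) Xnz by auto
  qed
  let ?d = "r1 - r2"
  have Y0: "?d * Y 0 = A + B" using sol[of 0] by simp
  have Y1: "?d * Y 1 = r1 * A + r2 * B" using sol[of 1] n by simp
  have Yn: "\<alpha> * (?d * Y n) = A * X + B / X"
  proof -
    have "B / X = B * (\<alpha> * r2 ^ n)" using Xinv by (simp add: divide_inverse)
    then show ?thesis using sol[of n] by (simp add: X_def t_def algebra_simps)
  qed
  have bc: "A * (r1 - \<phi> + e * X) + B * (r2 - \<phi> + e / X) = 0"
  proof -
    have "Y 0 = s * Y 1 - \<delta> * c * Y n" using step[of 0] n by simp
    then have "\<phi> * Y 0 = \<phi> * (s * Y 1 - \<delta> * c * Y n)" by (simp only:)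
    then have ph: "\<phi> * Y 0 = s * \<phi> * Y 1 - \<delta> * \<psi> * Y n" unfolding psi by (simp add: algebra_simps)
    have "\<phi> * (?d * Y 0) = ?d * (\<phi> * Y 0)" by (simp only: ac_simps)
    also have "\<dots> = ?d * Y 1 - \<delta> * \<psi> * (?d * Y n)"
      unfolding ph sphi mult_1 right_diff_distrib by (simp only: ac_simps)
    finally have "\<phi> * (?d * Y 0) = ?d * Y 1 - \<delta> * \<psi> * (?d * Y n)" .
    moreover have "e * (\<alpha> * (?d * Y n)) = - (\<delta> * \<psi> * (\<alpha> * \<alpha>) * (?d * Y n))"
      by (simp add: e_def)
    ultimately have "\<phi> * (?d * Y 0) = ?d * Y 1 + e * (\<alpha> * (?d * Y n))"
      unfolding aa by simp
    then have "\<phi> * (A + B) = r1 * A + r2 * B + e * (A * X + B / X)" unfolding Y0 Y1 Yn .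
    then show ?thesis by (simp add: algebra_simps)
  qed
  have "\<theta> * (\<alpha> * Y n) = (\<theta> - 1) * Y 0"
  proof -
    have "Y n = u (n - 1)" using n by (cases n) (simp_all add: Y_def)
    moreover have "Y 0 = s * u 0 - \<delta> * c * u (n - 1)" by (simp add: Y_def)
    ultimately show ?thesis using bdry by (simp only:)
  qed
  then have "?d * (\<theta> * (\<alpha> * Y n)) = ?d * ((\<theta> - 1) * Y 0)" by (simp only:)
  then have "\<theta> * (\<alpha> * (?d * Y n)) = (\<theta> - 1) * (?d * Y 0)" by (simp only: ac_simps)
  then have th: "\<theta> * (A * X + B / X) = (\<theta> - 1) * (A + B)" unfolding Y0 Yn .
  then have w: "(\<theta> - 1) * (A + B - (A * X + B / X)) = A * X + B / X"
    unfolding right_diff_distrib [of "\<theta> - 1" "A + B"] by (simp add: left_diff_distrib)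
  \<comment> \<open>otherwise both ends of the sequence vanish, which forces both modes to vanish as \<open>X\<^sup>2 \<noteq> 1\<close>\<close>
  have u: "A + B \<noteq> A * X + B / X"
  proof
    assume a: "A + B = A * X + B / X"
    then have "A * X + B / X = 0" using w by simp
    moreover from this have "A = - B" using a by (simp add: eq_neg_iff_add_eq_0)
    ultimately have "B * (X * X - 1) = 0" using Xnz by (simp add: field_simps)
    then show False using X2 AB \<open>A = - B\<close> by auto
  qed
  have "\<theta> - 1 = 1 / (r2 - r1) * ((r1 - \<phi> - e) / (1 - X) - (r2 - \<phi> - e) / (1 - 1 / X))"
    by (rule mode_ratio_omega[OF e2 Xnz X1 z(4) nz' bc w u])
  moreover have "- e = \<psi> * (\<delta> * \<alpha>)" by (simp add: e_def)
  ultimately have "\<theta> - 1 = 1 / (r2 - r1) * ((r1 - \<phi> + \<psi> * (\<delta> * \<alpha>)) / (1 - X)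
      - (r2 - \<phi> + \<psi> * (\<delta> * \<alpha>)) / (1 - 1 / X))"
    by (simp only: diff_conv_add_uminus)
  then show ?thesis
    unfolding Xinv unfolding X_def t_def r1_def r2_def by (simp only: diff_eq_eq add.commute)
qed

section \<open>The eigenvalues of the preconditioned matrix\<close>

text \<open>
  Write \<open>w = (y, p)\<close>. In all rows but two the blocks for \<open>0\<close> and for \<open>\<alpha>\<close> coincide, so that there the
  factor \<open>1 - \<theta>\<close> cancels; \<open>\<theta>\<close> survives only in the first row for \<open>y\<close> and in the last row for \<open>p\<close>.
  The resulting system is invariant under \<open>(y\<^sub>i, p\<^sub>i) \<mapsto> (p\<^sub>n\<^sub>-\<^sub>1\<^sub>-\<^sub>i, - y\<^sub>n\<^sub>-\<^sub>1\<^sub>-\<^sub>i)\<close>, a map with square \<open>-1\<close>. Its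
  eigenspaces for \<open>\<plusminus>\<i>\<close> decouple the system, and \<open>u\<^sub>i = y\<^sub>i + \<delta> p\<^sub>n\<^sub>-\<^sub>1\<^sub>-\<^sub>i\<close> with \<open>\<delta> = \<plusminus>\<i>\<close> is the coordinate on
  them. The product \<open>\<delta> \<alpha> = \<plusminus>\<i>\<close> selects the sign in \<open>\<omega>\<close>.
\<close>
lemma time_block_pencil_eigenvalue:
  fixes s c :: real and \<alpha> \<theta> :: complex
  assumes n: "2 \<le> n" and s: "s \<noteq> 0" and c: "c \<noteq> 0" and \<alpha>: "\<alpha> \<in> {1, -1}" and \<theta>: "\<theta> \<noteq> 1"
    and w: "w \<in> carrier_vec (n + n)" "w \<noteq> 0\<^sub>v (n + n)"
    and eq: "(time_block n c 0 + (- \<theta>) \<cdot>\<^sub>m time_block n c \<alpha>) *\<^sub>v w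
        = - ((1 - \<theta>) * complex_of_real (s - 1)) \<cdot>\<^sub>v w"
    and \<phi>: "\<phi> = inverse (of_real s)" and \<psi>: "\<psi> = of_real c * inverse (of_real s)"
  shows "\<theta> = 1 + omega1 n \<alpha> \<phi> \<psi> \<or> \<theta> = 1 + omega2 n \<alpha> \<phi> \<psi>"
proof -
  define y p where "y = vec_first w n" and "p = vec_last w n"
  have y: "y \<in> carrier_vec n" and p: "p \<in> carrier_vec n" and wyp: "w = y @\<^sub>v p"
    using w by (simp_all add: y_def p_def)
  have cnj\<alpha>: "cnj \<alpha> = \<alpha>" using \<alpha> by auto
  have C: "dim_vec (C_mat n \<beta> *\<^sub>v v) = n" "dim_vec (mat_adjoint (C_mat n \<beta>) *\<^sub>v v) = n" for \<beta> v
    using carrier_matD[OF C_mat_carrier[of n \<beta>]]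
      carrier_matD[OF mat_adjoint_carrier[OF C_mat_carrier[of n \<beta>]]] by auto
  have eq': "time_block n c 0 *\<^sub>v w + (- \<theta>) \<cdot>\<^sub>v (time_block n c \<alpha> *\<^sub>v w)
        = - ((1 - \<theta>) * complex_of_real (s - 1)) \<cdot>\<^sub>v w"
    using eq w(1) carrier_matD[OF time_block_carrier[of n c \<alpha>]]
      add_mult_distrib_mat_vec[of "time_block n c 0" "n + n" "n + n" "(- \<theta>) \<cdot>\<^sub>m time_block n c \<alpha>" w]
    by (simp add: smult_mat_mult_vec)
  have row: "(time_block n c 0 *\<^sub>v w) $ i - \<theta> * (time_block n c \<alpha> *\<^sub>v w) $ i
      = - ((1 - \<theta>) * complex_of_real (s - 1)) * w $ i" if "i < n + n" for i
    using arg_cong[OF eq', of "\<lambda>x. x $ i"] that w(1)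
      carrier_matD[OF time_block_carrier[of n c \<alpha>]] carrier_matD[OF time_block_carrier[of n c 0]]
    by simp
  have cancel: "a = b" if "(1 - \<theta>) * a = (1 - \<theta>) * b" for a b
    using that \<theta> by simp
  have ty: "(time_block n c \<beta> *\<^sub>v w) $ i
      = y $ i - (if i = 0 then \<beta> * y $ (n - 1) else y $ (i - 1)) + c * p $ i" if i: "i < n" for i \<beta>
    unfolding wyp time_block_mult_append[OF y p] C_mat_mult_vec[OF n i y, symmetric]
    using i y p C by simp
  have tp: "(time_block n c \<beta> *\<^sub>v w) $ (n + i)
      = p $ i - (if i = n - 1 then cnj \<beta> * p $ 0 else p $ Suc i) - c * y $ i" if i: "i < n" for i \<beta>
    unfolding wyp time_block_mult_append[OF y p] C_mat_adjoint_mult_vec[OF n i p, symmetric]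
    using i y p C by simp
  have wy: "w $ i = y $ i" and wp: "w $ (n + i) = p $ i" if "i < n" for i
    using that y p by (simp_all add: wyp)
  note tp' = tp[unfolded add.commute[of n]] and wp' = wp[unfolded add.commute[of n]]
  have rec_y: "y $ i = s * y $ Suc i + c * p $ Suc i" if i: "Suc i < n" for i
    by (rule cancel)
      (use row[of "Suc i"] i in \<open>simp add: ty wy algebra_simps\<close>)
  have rec_p: "p $ Suc i = s * p $ i - c * y $ i" if i: "Suc i < n" for i
  proof (rule cancel)
    have "i \<noteq> n - Suc 0" using i by simp
    then show "(1 - \<theta>) * p $ Suc i = (1 - \<theta>) * (s * p $ i - c * y $ i)"
      using row[of "n + i"] i by (simp add: tp' wp' algebra_simps)
  qed
  have bd_y: "\<theta> * (\<alpha> * y $ (n - 1)) = (\<theta> - 1) * (s * y $ 0 + c * p $ 0)"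
    using row[of 0] n by (simp add: ty wy algebra_simps)
  have bd_p: "\<theta> * (\<alpha> * p $ 0) = (\<theta> - 1) * (s * p $ (n - 1) - c * y $ (n - 1))"
  proof -
    define m where "m = n - Suc 0"
    have "m < n" "n - Suc 0 = m" using n by (simp_all add: m_def)
    then show ?thesis using row[of "n + m"] by (simp add: tp' wp' cnj\<alpha> algebra_simps)
  qed
  have main: "\<theta> = 1 + 1 / (z2 \<phi> \<psi> - z1 \<phi> \<psi>) *
     ((z1 \<phi> \<psi> - \<phi> + \<psi> * (\<delta> * \<alpha>)) / (1 - \<alpha> * z1 \<phi> \<psi> ^ n)
      - (z2 \<phi> \<psi> - \<phi> + \<psi> * (\<delta> * \<alpha>)) / (1 - \<alpha> * z2 \<phi> \<psi> ^ n))"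
    if \<delta>: "\<delta> \<in> {\<i>, - \<i>}" and i: "i < n" and nz: "y $ i + \<delta> * p $ (n - Suc i) \<noteq> 0" for \<delta> i
  proof -
    define u where "u i = y $ i + \<delta> * p $ (n - Suc i)" for i
    have dd: "\<delta> * \<delta> = -1" using \<delta> by auto
    \<comment> \<open>as \<open>\<delta>\<^sup>2 = -1\<close>, the \<open>p\<close>-part of \<open>- \<delta> c u\<close> is the coupling term \<open>c p\<close> of the equation for \<open>y\<close>\<close>
    have fold: "s * a + c * b' + \<delta> * (s * b - c * a') = s * (a + \<delta> * b) - \<delta> * c * (a' + \<delta> * b')"
      for a b a' b' :: complex
    proof -
      have "s * (a + \<delta> * b) - \<delta> * c * (a' + \<delta> * b')
          = s * a + \<delta> * (s * b - c * a') - (\<delta> * \<delta>) * (c * b')"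
        by (simp add: algebra_simps)
      then show ?thesis unfolding dd by simp
    qed
    show ?thesis
    proof (rule reflection_recurrence_eigenvalue[OF _ s c \<alpha> \<delta> _ _ i _ \<phi> \<psi>, of u])
      show "0 < n" using n by simp
      show "u i \<noteq> 0" using nz by (simp add: u_def)
    next
      fix i assume i: "Suc i < n"
      define k where "k = n - Suc (Suc i)"
      have k: "n - Suc (Suc i) = k" "n - Suc i = Suc k" "n - Suc k = Suc i" "Suc k < n"
        using i by (auto simp: k_def)
      have "u i = s * y $ Suc i + c * p $ Suc i + \<delta> * (s * p $ k - c * y $ k)"
        unfolding u_def k(2) using rec_y[OF i] rec_p[OF k(4)] by (simp only:)
      then show "u i = s * u (Suc i) - \<delta> * c * u (n - Suc (Suc i))"
        unfolding fold k(1) u_def k(3) .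
    next
      have "n - Suc (n - 1) = 0" using n by simp
      then have u0: "u (n - 1) = y $ (n - 1) + \<delta> * p $ 0" "u 0 = y $ 0 + \<delta> * p $ (n - 1)"
        by (simp_all add: u_def)
      have "\<theta> * (\<alpha> * u (n - 1)) = \<theta> * (\<alpha> * y $ (n - 1)) + \<delta> * (\<theta> * (\<alpha> * p $ 0))"
        unfolding u0 by (simp add: algebra_simps)
      also have "\<dots> = (\<theta> - 1) * (s * y $ 0 + c * p $ 0 + \<delta> * (s * p $ (n - 1) - c * y $ (n - 1)))"
        unfolding bd_y bd_p by (simp only: distrib_left ac_simps)
      finally show "\<theta> * (\<alpha> * u (n - 1)) = (\<theta> - 1) * (s * u 0 - \<delta> * c * u (n - 1))"
        unfolding fold u0 .
    qed
  qed
  have "\<exists>i<n. y $ i \<noteq> 0 \<or> p $ i \<noteq> 0"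
  proof (rule ccontr)
    assume "\<not> ?thesis"
    then have "w = 0\<^sub>v (n + n)" using y p unfolding wyp by (auto simp: vec_eq_iff append_vec_def)
    then show False using w by simp
  qed
  then obtain j where j: "j < n" "y $ j \<noteq> 0 \<or> p $ j \<noteq> 0" by blast
  have "\<exists>i<n. y $ i \<noteq> 0 \<or> p $ (n - Suc i) \<noteq> 0"
  proof (cases "y $ j = 0")
    case True
    then show ?thesis using j by (intro exI[of _ "n - Suc j"]) auto
  qed (use j in blast)
  then obtain i where i: "i < n" "y $ i \<noteq> 0 \<or> p $ (n - Suc i) \<noteq> 0" by blast
  \<comment> \<open>if both combinations vanished, so would \<open>y\<^sub>i\<close> and \<open>p\<^sub>n\<^sub>-\<^sub>1\<^sub>-\<^sub>i\<close>\<close>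
  then have "y $ i + \<i> * p $ (n - Suc i) \<noteq> 0 \<or> y $ i + (- \<i>) * p $ (n - Suc i) \<noteq> 0"
    by (auto simp: add_eq_0_iff)
  then obtain \<delta> where \<delta>: "\<delta> \<in> {\<i>, - \<i>}" "y $ i + \<delta> * p $ (n - Suc i) \<noteq> 0" by blast
  have "\<delta> * \<alpha> \<in> {\<i>, - \<i>}" using \<delta>(1) \<alpha> by auto
  then show ?thesis using main[OF \<delta>(1) i(1) \<delta>(2)] by (auto simp: omega1_def omega2_def)
qed

theorem corollary2p2:
  fixes L M :: nat and \<tau> \<gamma> :: real and \<alpha> :: complex
    and K :: "complex mat" and \<sigma> :: "nat \<Rightarrow> complex"
  assumes "L > 4" and "\<tau> > 0" and "\<gamma> > 0"
    and "K \<in> carrier_mat M M" and "mat_adjoint K = K"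
    and "char_poly K = (\<Prod>m = 1..M. [:- \<sigma> m, 1:])"
    and "\<And>m. m \<in> {1..M} \<Longrightarrow> 1 + complex_of_real \<tau> * \<sigma> m \<noteq> 0"
    and "\<alpha> \<in> {1, - 1}"
  shows "invertible_mat (P_mat (L - 1) \<tau> \<gamma> K \<alpha>) \<and>
    (\<forall>\<theta>. eigenvalue (the (mat_inverse (P_mat (L - 1) \<tau> \<gamma> K \<alpha>)) * A_hat (L - 1) \<tau> \<gamma> K) \<theta> \<longrightarrow>
      \<theta> = 1 \<or>
      (\<exists>m \<in> {1..M}.
        \<theta> = 1 + omega1 (L - 1) \<alpha> (phi \<tau> (\<sigma> m)) (psi \<tau> \<gamma> (\<sigma> m)) \<or>
        \<theta> = 1 + omega2 (L - 1) \<alpha> (phi \<tau> (\<sigma> m)) (psi \<tau> \<gamma> (\<sigma> m))))"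
proof -
  define n where "n = L - 1"
  define c where "c = \<tau> / sqrt \<gamma>"
  define N where "N = n + n"
  let ?P = "P_mat n \<tau> \<gamma> K" and ?T = "time_block n c"
  have n: "2 \<le> n" using assms(1) by (simp add: n_def)
  have c: "c \<noteq> 0" using assms(2,3) by (simp add: c_def)
  note K = assms(4)
  have T: "?T \<beta> \<in> carrier_mat N N" for \<beta> by (simp add: N_def)
  have P_eq: "?P \<beta> = ?T \<beta> \<otimes>\<^sub>K 1\<^sub>m M + complex_of_real \<tau> \<cdot>\<^sub>m (1\<^sub>m N \<otimes>\<^sub>K K)" for \<beta>
    unfolding N_def c_def by (rule P_mat_eq[OF K])
  have TI: "?T \<beta> \<otimes>\<^sub>K 1\<^sub>m M \<in> carrier_mat (N * M) (N * M)" for \<beta>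
    using T[of \<beta>] by simp
  have IK: "1\<^sub>m N \<otimes>\<^sub>K K \<in> carrier_mat (N * M) (N * M)" using K by simp
  have P: "?P \<beta> \<in> carrier_mat (N * M) (N * M)" for \<beta>
    unfolding P_eq using TI[of \<beta>] IK by simp
  have real: "\<exists>r. \<sigma> m = complex_of_real r" if m: "m \<in> {1..M}" for m
  proof -
    have "poly (char_poly K) (\<sigma> m) = 0"
      unfolding assms(6) poly_prod using m by (intro prod_zero bexI[of _ m]) auto
    then have "\<sigma> m \<in> \<real>"
      using self_adjoint_eigenvalue_real[OF K assms(5)] eigenvalue_root_char_poly[OF K] by blast
    then show ?thesis by (auto elim: Reals_cases)
  qed
  have trivial_kernel: "v = 0\<^sub>v (N * M)"
    if v: "v \<in> carrier_vec (N * M)" and Pv: "?P \<alpha> *\<^sub>v v = 0\<^sub>v (N * M)" for v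
  proof (rule ccontr)
    assume "v \<noteq> 0\<^sub>v (N * M)"
    then obtain m w where m: "m \<in> {1..M}" and w: "w \<in> carrier_vec N" "w \<noteq> 0\<^sub>v N"
      and eq: "?T \<alpha> *\<^sub>v w = - (complex_of_real \<tau> * \<sigma> m) \<cdot>\<^sub>v w"
      using kronecker_sum_kernel[OF T K assms(6) v _ Pv[unfolded P_eq]] by blast
    obtain r where "\<sigma> m = complex_of_real r" using real[OF m] by blast
    then have "?T \<alpha> *\<^sub>v w = complex_of_real (- (\<tau> * r)) \<cdot>\<^sub>v w" using eq by simp
    then have "w = 0\<^sub>v N"
      using time_block_no_real_eigenvalue[OF c] w(1) unfolding N_def by blast
    then show False using w(2) by simp
  qed
  obtain Q where Q: "mat_inverse (?P \<alpha>) = Some Q" "Q \<in> carrier_mat (N * M) (N * M)"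
    "?P \<alpha> * Q = 1\<^sub>m (N * M)" and inv: "invertible_mat (?P \<alpha>)"
    using invertible_if_trivial_kernel[OF P trivial_kernel] by blast
  have "\<theta> = 1 \<or> (\<exists>m \<in> {1..M}.
        \<theta> = 1 + omega1 n \<alpha> (phi \<tau> (\<sigma> m)) (psi \<tau> \<gamma> (\<sigma> m)) \<or>
        \<theta> = 1 + omega2 n \<alpha> (phi \<tau> (\<sigma> m)) (psi \<tau> \<gamma> (\<sigma> m)))"
    if ev: "eigenvalue (the (mat_inverse (?P \<alpha>)) * A_hat n \<tau> \<gamma> K) \<theta>" for \<theta>
  proof (cases "\<theta> = 1")
    case False
    have "eigenvalue (Q * ?P 0) \<theta>" using ev by (simp add: Q(1) A_hat_eq_P_mat_0[OF n])
    then obtain v where v: "v \<in> carrier_vec (N * M)" "v \<noteq> 0\<^sub>v (N * M)"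
      and ker: "(?P 0 + (- \<theta>) \<cdot>\<^sub>m ?P \<alpha>) *\<^sub>v v = 0\<^sub>v (N * M)"
      using preconditioned_eigenvalueE[OF P P Q(2,3)] by blast
    let ?X = "?T 0 + (- \<theta>) \<cdot>\<^sub>m ?T \<alpha>"
    have X: "?X \<in> carrier_mat N N" using T[of 0] T[of \<alpha>] by simp
    have "?P 0 + (- \<theta>) \<cdot>\<^sub>m ?P \<alpha>
        = ?X \<otimes>\<^sub>K 1\<^sub>m M + ((1 - \<theta>) * complex_of_real \<tau>) \<cdot>\<^sub>m (1\<^sub>m N \<otimes>\<^sub>K K)"
      unfolding P_eq kronecker_add_smult_left[OF T T one_carrier_mat]
      using TI[of 0] TI[of \<alpha>] IK by (intro eq_matI) (auto simp: algebra_simps)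
    from kronecker_sum_kernel[OF X K assms(6) v ker[unfolded this]]
    obtain m w where m: "m \<in> {1..M}" and w: "w \<in> carrier_vec N" "w \<noteq> 0\<^sub>v N"
      and eq: "?X *\<^sub>v w = - ((1 - \<theta>) * complex_of_real \<tau> * \<sigma> m) \<cdot>\<^sub>v w" by blast
    obtain r where r: "\<sigma> m = complex_of_real r" using real[OF m] by blast
    define s where "s = 1 + \<tau> * r"
    have s_eq: "complex_of_real s = 1 + complex_of_real \<tau> * \<sigma> m" by (simp add: s_def r)
    then have s: "s \<noteq> 0" using assms(7)[OF m] by auto
    have tau: "(1 - \<theta>) * complex_of_real \<tau> * \<sigma> m = (1 - \<theta>) * complex_of_real (s - 1)"
      by (simp add: s_def r)
    have "\<theta> = 1 + omega1 n \<alpha> (phi \<tau> (\<sigma> m)) (psi \<tau> \<gamma> (\<sigma> m)) \<or>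
        \<theta> = 1 + omega2 n \<alpha> (phi \<tau> (\<sigma> m)) (psi \<tau> \<gamma> (\<sigma> m))"
      by (rule time_block_pencil_eigenvalue[OF n s c assms(8) False w[unfolded N_def] eq[unfolded tau]])
        (simp_all only: phi_def psi_def s_eq c_def)
    then show ?thesis using m by blast
  qed simp
  then show ?thesis using inv unfolding n_def by blast
qed

end
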